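(* For each $n\ge 1$ let $\mathcal E^n=\{P^n_\theta:\theta\in\Theta\}$ be a statistical experiment generated by an observation $Y^n$. Let $d$ be a pre-metric on $\Theta$, let $\ell:\Theta\times\Theta\to[0,\infty)$ be a pseudo-metric, let $\Theta_0\subset\Theta$, let $\pi$ be a prior on $\Theta$ with posterior $P^\pi(\cdot\mid Y^n)$, and let $(\epsilon_n(\theta),\theta\in\Theta_0)$, $n\ge1$, be a family of positive sequences. Assume: (1) (posterior concentration) as $n\to\infty$, $$\sup_{\theta_0\in\Theta_0}E^n_{\theta_0}\big[P^\pi\big(\theta:\ell(\theta_0,\theta)\ge\epsilon_n(\theta_0)\mid Y^n\big)\big]=o(1);$$ (2) the family $\{P^n_\theta:\theta\in\Theta_0\}$ is dominated by some $\sigma$-finite measure $\mu$ and there is a constant $K>0$ such that, with $\mathcal L_n(\theta)=\log\frac{dP^n_\theta}{d\mu}(Y^n)$, $$P^n_{\theta'}\big(\mathcal L_n(\theta')-\mathcal L_n(\theta)\ge K\,n\,d(\theta,\theta')^2\big)=o(1)$$ uniformly over all $\theta,\theta'\in\Theta_0$ satisfying $\Omega(\epsilon_n(\cdot),\theta,\ell)\le d(\theta,\theta')\le 2\,\Omega(\epsilon_n(\cdot),\theta,\ell)$; (3) $n\,\Omega(\epsilon_n(\cdot),\Theta_0,\ell)^2\to\infty$. Then for all $\theta_0\in\Theta_0$ and all large enough $n$, $$E^n_{\theta_0}\big[P^\pi\big(\theta:\ell(\theta_0,\theta)>\epsilon_n(\theta_0)\mid Y^n\big)\big]\ \ge\ 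e^{-3K\,n\,\Omega(\epsilon_n(\cdot),\theta_0,\ell)^2}.$$
   Context: A pre-metric $d$ on $\Theta$ is a function $d:\Theta\times\Theta\to[0,\infty)$ with $d(\theta,\theta')=0$ iff $\theta=\theta'$ (no symmetry or triangle inequality required). A pseudo-metric $\ell$ satisfies the axioms of a metric except that $\ell(\theta,\theta')=0$ is allowed for some $\theta\ne\theta'$. For a family of positive radii $\epsilon(\cdot)=(\epsilon(\theta),\theta\in\Theta_0)$, define the local modulus $$\Omega(\epsilon(\cdot),\theta,\ell)=\inf\{d(\theta,\theta'):\ \ell(\theta,\theta')\ge\epsilon(\theta)+\epsilon(\theta'),\ \theta'\in\Theta_0\},\qquad\theta\in\Theta_0,$$ and the global modulus $\Omega(\epsilon(\cdot),\Theta_0,\ell)=\inf_{\theta\in\Theta_0}\Omega(\epsilon(\cdot),\theta,\ell)$ (with $\inf\varnothing=+\infty$). $E^n_\theta$ denotes expectation under $P^n_\theta$, and $P^\pi(\cdot\mid Y^n)$ is the posterior distribution on $\Theta$ given $Y^n$ under the prior $\pi$. All sets whose posterior probability is considered are assumed measurable. *)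

theory Defs
  imports "HOL-Probability.Probability"
begin

definition pre_metric_on :: "'t set \<Rightarrow> ('t \<Rightarrow> 't \<Rightarrow> real) \<Rightarrow> bool" where
  "pre_metric_on \<Theta> d \<longleftrightarrow>
     (\<forall>\<theta>\<in>\<Theta>. \<forall>\<theta>'\<in>\<Theta>. 0 \<le> d \<theta> \<theta>' \<and> (d \<theta> \<theta>' = 0 \<longleftrightarrow> \<theta> = \<theta>'))"

definition pseudo_metric_on :: "'t set \<Rightarrow> ('t \<Rightarrow> 't \<Rightarrow> real) \<Rightarrow> bool" where
  "pseudo_metric_on \<Theta> l \<longleftrightarrow>
     (\<forall>\<theta>\<in>\<Theta>. l \<theta> \<theta> = 0) \<and>
     (\<forall>\<theta>\<in>\<Theta>. \<forall>\<theta>'\<in>\<Theta>. 0 \<le> l \<theta> \<theta>' \<and> l \<theta> \<theta>' = l \<theta>' \<theta>) \<and>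
     (\<forall>\<theta>\<in>\<Theta>. \<forall>\<theta>'\<in>\<Theta>. \<forall>\<theta>''\<in>\<Theta>. l \<theta> \<theta>'' \<le> l \<theta> \<theta>' + l \<theta>' \<theta>'')"

text \<open>The moduli are extended-real valued: the infimum over the empty set is infinite.\<close>

definition local_modulus ::
  "('t \<Rightarrow> 't \<Rightarrow> real) \<Rightarrow> 't set \<Rightarrow> ('t \<Rightarrow> real) \<Rightarrow> 't \<Rightarrow> ('t \<Rightarrow> 't \<Rightarrow> real) \<Rightarrow> ennreal" where
  "local_modulus d \<Theta>\<^sub>0 \<epsilon> \<theta> l =
     (INF \<theta>' \<in> {\<theta>' \<in> \<Theta>\<^sub>0. l \<theta> \<theta>' \<ge> \<epsilon> \<theta> + \<epsilon> \<theta>'}. ennreal (d \<theta> \<theta>'))"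

definition global_modulus ::
  "('t \<Rightarrow> 't \<Rightarrow> real) \<Rightarrow> 't set \<Rightarrow> ('t \<Rightarrow> real) \<Rightarrow> ('t \<Rightarrow> 't \<Rightarrow> real) \<Rightarrow> ennreal" where
  "global_modulus d \<Theta>\<^sub>0 \<epsilon> l = (INF \<theta>\<in>\<Theta>\<^sub>0. local_modulus d \<Theta>\<^sub>0 \<epsilon> \<theta> l)"

text \<open>
  A statistical experiment with parameter space \<open>space \<pi>\<close> and sample space \<open>S\<close> is a probability
  kernel \<open>P\<close>; of \<open>S\<close> only the underlying measurable space matters. The posterior
  \<open>Q\<close> is a regular conditional distribution of the parameter given the observation,
  under the joint law in which the parameter has law \<open>\<pi>\<close> and the observation has conditional
  law \<open>P \<theta>\<close>; the marginal law of the observation is \<open>\<pi> \<bind> P\<close>.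
\<close>

definition is_posterior ::
  "'t measure \<Rightarrow> 'y measure \<Rightarrow> ('t \<Rightarrow> 'y measure) \<Rightarrow> ('y \<Rightarrow> 't measure) \<Rightarrow> bool" where
  "is_posterior \<pi> S P Q \<longleftrightarrow>
     Q \<in> S \<rightarrow>\<^sub>M prob_algebra \<pi> \<and>
     (\<forall>A\<in>sets S. \<forall>B\<in>sets \<pi>.
        (\<integral>\<^sup>+\<theta>\<in>B. emeasure (P \<theta>) A \<partial>\<pi>) = (\<integral>\<^sup>+y\<in>A. emeasure (Q y) B \<partial>(\<pi> \<bind> P)))"

text \<open>
  Densities may vanish, so the logarithm takes the value \<open>-\<infinity>\<close> at zero, in contrast to
  \<^term>\<open>ln (0::real)\<close>, which is zero.
\<close>

definition ext_ln :: "ennreal \<Rightarrow> ereal" where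
  "ext_ln x = (if x = 0 then -\<infinity> else if x = \<infinity> then \<infinity> else ereal (ln (enn2real x)))"

definition log_lik :: "'y measure \<Rightarrow> 'y measure \<Rightarrow> 'y \<Rightarrow> ereal" where
  "log_lik \<mu> P y = ext_ln (RN_deriv \<mu> P y)"

text \<open>The function \<open>x \<mapsto> exp (-x)\<close>, with \<open>exp (-\<infinity>) = 0\<close>.\<close>

definition exp_neg :: "ennreal \<Rightarrow> real" where
  "exp_neg x = (if x = \<infinity> then 0 else exp (- enn2real x))"

end

theory Submission
  imports Defs
begin

text \<open>
  The theorem is a two-point argument. A parameter \<open>\<theta>'\<close> with
  \<open>l \<theta>\<^sub>0 \<theta>' \<ge> \<epsilon> \<theta>\<^sub>0 + \<epsilon> \<theta>'\<close> is so far from \<open>\<theta>\<^sub>0\<close> that, by the triangle inequality, a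
  posterior which concentrates within \<open>\<epsilon> \<theta>'\<close> of \<open>\<theta>'\<close> puts its mass outside the ball of radius
  \<open>\<epsilon> \<theta>\<^sub>0\<close> around \<open>\<theta>\<^sub>0\<close>. Under \<open>P \<theta>'\<close> the posterior does concentrate around \<open>\<theta>'\<close>, so the mass that
  it gives to the complement of the ball around \<open>\<theta>\<^sub>0\<close> has expectation close to one under the
  \<^emph>\<open>wrong\<close> law \<open>P \<theta>'\<close>. Passing to the right law \<open>P \<theta>\<^sub>0\<close> costs at most a factor
  \<open>exp (K n d\<^sup>2)\<close>, with \<open>d\<close> short for \<open>d \<theta>\<^sub>0 \<theta>'\<close>, outside an event of small probability
  under \<open>P \<theta>'\<close>; this change of measure is lemma \<open>expectation_change_of_measure\<close>.

  The exponent is then made small by the choice of \<open>\<theta>'\<close>: with \<open>\<Omega>\<close> for the local modulus at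
  \<open>\<theta>\<^sub>0\<close>, some admissible \<open>\<theta>'\<close> has \<open>d \<theta>\<^sub>0 \<theta>' \<le> 5/4 \<Omega>\<close>, because
  \<open>\<Omega>\<close> is a positive infimum. The factor 2 that the likelihood assumption permits would give
  the exponent \<open>4 K n \<Omega>\<^sup>2\<close>, which exceeds \<open>3 K n \<Omega>\<^sup>2\<close>; with 5/4 the exponent is
  \<open>25/16 K n \<Omega>\<^sup>2\<close>. What is left of \<open>3 K n \<Omega>\<^sup>2\<close> absorbs the constant factor 1/2 lost to the
  two small error terms, because \<open>n \<Omega>\<^sup>2\<close> is bounded below by \<open>n\<close> times the squared global modulus,
  which tends to infinity. All bounds that depend on \<open>n\<close> hold uniformly over \<open>\<Theta>\<^sub>0\<close>, so one
  threshold for \<open>n\<close> serves every \<open>\<theta>\<^sub>0\<close>. If no admissible \<open>\<theta>'\<close> exists, then \<open>\<Omega>\<close> is infinite and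
  the claimed lower bound is zero.
\<close>

section \<open>Log-likelihood ratios and change of measure\<close>

lemma measurable_ext_ln [measurable]: "ext_ln \<in> borel_measurable borel"
  unfolding ext_ln_def by measurable

lemma measurable_log_lik [measurable]:
  "log_lik \<mu> P \<in> borel_measurable \<mu>"
  unfolding log_lik_def by measurable

text \<open>
  Extended arithmetic needs no exceptional set here: in \<^typ>\<open>ereal\<close> both \<open>-\<infinity> - -\<infinity>\<close>
  and \<open>\<infinity> - \<infinity>\<close> equal \<open>\<infinity>\<close>, so a difference below a real number forces \<open>p \<noteq> 0\<close> and
  \<open>p' \<noteq> \<infinity>\<close>. Hence the density bound holds at every point of the event, not just almost
  everywhere.
\<close>

lemma le_exp_mult_if_ext_ln_diff_less:
  assumes "ext_ln p' - ext_ln p < ereal c"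
  shows "p' \<le> ennreal (exp c) * p"
proof (cases "p' = 0 \<or> p = \<infinity>")
  case True
  then show ?thesis by (auto simp: ennreal_mult_top)
next
  case False
  have p: "p \<noteq> 0" using assms by (auto simp: ext_ln_def)
  have p': "p' \<noteq> \<infinity>" using assms False p by (auto simp: ext_ln_def)
  obtain a where a: "p = ennreal a" "a > 0"
    using p False by (cases p) (auto simp: less_eq_real_def)
  obtain b where b: "p' = ennreal b" "b > 0"
    using p' False by (cases p') (auto simp: less_eq_real_def)
  have "ln b < c + ln a"
    using assms a b by (simp add: ext_ln_def)
  also have "c + ln a = ln (exp c * a)"
    using a by (simp add: ln_mult)
  finally have "b < exp c * a"
    using a b by (subst (asm) ln_less_cancel_iff) auto
  then show ?thesis
    using a b by (simp add: ennreal_mult' [symmetric] ennreal_leI)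
qed

text \<open>
  On the event where the log-likelihood ratio is below \<open>c\<close>, the law \<open>P'\<close> is at most
  \<open>exp c\<close> times \<open>P\<close>; on the complement, \<open>f \<le> 1\<close> bounds the expectation by the probability.
\<close>

lemma expectation_change_of_measure:
  fixes f :: "'y \<Rightarrow> real"
  assumes \<mu>: "sigma_finite_measure \<mu>"
    and P: "prob_space P" "sets P = sets \<mu>" "absolutely_continuous \<mu> P"
    and P': "prob_space P'" "sets P' = sets \<mu>" "absolutely_continuous \<mu> P'"
    and f [measurable]: "f \<in> borel_measurable \<mu>"
    and f01: "\<And>y. y \<in> space \<mu> \<Longrightarrow> 0 \<le> f y" "\<And>y. y \<in> space \<mu> \<Longrightarrow> f y \<le> 1"
  shows "(\<integral>y. f y \<partial>P') \<le>
    measure P' {y \<in> space \<mu>. log_lik \<mu> P' y - log_lik \<mu> P y \<ge> ereal c} + exp c * (\<integral>y. f y \<partial>P)"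
proof -
  interpret sigma_finite_measure \<mu> by fact
  interpret P: prob_space P by fact
  interpret P': prob_space P' by fact
  define A where "A = {y \<in> space \<mu>. log_lik \<mu> P' y - log_lik \<mu> P y \<ge> ereal c}"
  have A [measurable]: "A \<in> sets \<mu>"
    unfolding A_def by measurable
  have dP: "P = density \<mu> (RN_deriv \<mu> P)" and dP': "P' = density \<mu> (RN_deriv \<mu> P')"
    using P P' by (simp_all add: density_RN_deriv)
  have sp: "space P = space \<mu>" "space P' = space \<mu>"
    using P(2) P'(2) by (simp_all add: sets_eq_imp_space_eq[of P] sets_eq_imp_space_eq[of P'])
  have fP [measurable]: "f \<in> borel_measurable P" "f \<in> borel_measurable P'"
    using f P P' by (simp_all cong: measurable_cong_sets)
  have A': "A \<in> sets P'" using A P' by simp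
  have int: "integrable P f" "integrable P' f"
    using f01 sp by (auto intro!: P.integrable_const_bound[of _ 1] P'.integrable_const_bound[of _ 1])
  have "(\<integral>\<^sup>+y. ennreal (f y) \<partial>P') \<le> (\<integral>\<^sup>+y. indicator A y + ennreal (f y) * indicator (space \<mu> - A) y \<partial>P')"
    using f01 sp by (intro nn_integral_mono) (auto split: split_indicator)
  also have "\<dots> = emeasure P' A + (\<integral>\<^sup>+y. ennreal (f y) * indicator (space \<mu> - A) y \<partial>P')"
    using P' A' by (subst nn_integral_add) (auto cong: measurable_cong_sets)
  also have "(\<integral>\<^sup>+y. ennreal (f y) * indicator (space \<mu> - A) y \<partial>P') =
      (\<integral>\<^sup>+y. RN_deriv \<mu> P' y * (ennreal (f y) * indicator (space \<mu> - A) y) \<partial>\<mu>)"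
    by (subst dP', subst nn_integral_density) auto
  also have "\<dots> \<le> (\<integral>\<^sup>+y. ennreal (exp c) * (RN_deriv \<mu> P y * ennreal (f y)) \<partial>\<mu>)"
  proof (intro nn_integral_mono)
    fix y assume y: "y \<in> space \<mu>"
    show "RN_deriv \<mu> P' y * (ennreal (f y) * indicator (space \<mu> - A) y)
      \<le> ennreal (exp c) * (RN_deriv \<mu> P y * ennreal (f y))"
    proof (cases "y \<in> A")
      case False
      then have "log_lik \<mu> P' y - log_lik \<mu> P y < ereal c"
        using y by (auto simp: A_def)
      then have "RN_deriv \<mu> P' y \<le> ennreal (exp c) * RN_deriv \<mu> P y"
        unfolding log_lik_def by (rule le_exp_mult_if_ext_ln_diff_less)
      then show ?thesis
        using False y by (simp add: mult.assoc [symmetric] mult_right_mono)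
    qed simp
  qed
  also have "\<dots> = ennreal (exp c) * (\<integral>\<^sup>+y. ennreal (f y) \<partial>P)"
    by (subst (2) dP, subst nn_integral_density) (auto simp: nn_integral_cmult)
  finally have "(\<integral>\<^sup>+y. ennreal (f y) \<partial>P') \<le> emeasure P' A + ennreal (exp c) * (\<integral>\<^sup>+y. ennreal (f y) \<partial>P)"
    by (simp add: add_left_mono)
  moreover have "(\<integral>\<^sup>+y. ennreal (f y) \<partial>P') = ennreal (\<integral>y. f y \<partial>P')"
    using f01 sp int by (intro nn_integral_eq_integral) auto
  moreover have "(\<integral>\<^sup>+y. ennreal (f y) \<partial>P) = ennreal (\<integral>y. f y \<partial>P)"
    using f01 sp int by (intro nn_integral_eq_integral) auto
  moreover have nn: "0 \<le> (\<integral>y. f y \<partial>P)"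
    using f01 sp by (intro integral_nonneg_AE) auto
  ultimately have "ennreal (\<integral>y. f y \<partial>P') \<le> ennreal (measure P' A + exp c * (\<integral>y. f y \<partial>P))"
    by (simp add: P'.emeasure_eq_measure ennreal_mult' ennreal_plus)
  then show ?thesis
    using nn by (subst (asm) ennreal_le_iff) (auto simp: A_def)
qed

section \<open>Posterior mass under a distant parameter\<close>

text \<open>
  The triangle inequality makes the complement of the open \<open>\<theta>'\<close>-ball and the complement of the
  closed \<open>\<theta>\<^sub>0\<close>-ball cover the parameter space, so their posterior probabilities add up to at
  least one for every observation. The likelihood enters only in the step from \<open>P \<theta>'\<close> to
  \<open>P \<theta>\<^sub>0\<close>.
\<close>

lemma posterior_mass_outside_ball_lower_bound:
  fixes l :: "'t \<Rightarrow> 't \<Rightarrow> real"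
  assumes l: "pseudo_metric_on (space \<pi>) l"
    and Q: "Q \<in> S \<rightarrow>\<^sub>M prob_algebra \<pi>"
    and \<mu>: "sigma_finite_measure \<mu>" "sets \<mu> = sets S"
    and P: "P \<in> space (prob_algebra S)" "absolutely_continuous \<mu> P"
    and P': "P' \<in> space (prob_algebra S)" "absolutely_continuous \<mu> P'"
    and \<theta>: "\<theta>\<^sub>0 \<in> space \<pi>" "\<theta>' \<in> space \<pi>" "l \<theta>\<^sub>0 \<theta>' \<ge> r + r'"
    and G: "{\<theta>\<in>space \<pi>. l \<theta>\<^sub>0 \<theta> > r} \<in> sets \<pi>"
    and G': "{\<theta>\<in>space \<pi>. l \<theta>' \<theta> \<ge> r'} \<in> sets \<pi>"
    and conc: "(\<integral>y. measure (Q y) {\<theta>\<in>space \<pi>. l \<theta>' \<theta> \<ge> r'} \<partial>P') \<le> a"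
    and lik: "measure P' {y \<in> space S. log_lik \<mu> P' y - log_lik \<mu> P y \<ge> ereal c} \<le> b"
  shows "(1 - a - b) * exp (- c) \<le> (\<integral>y. measure (Q y) {\<theta>\<in>space \<pi>. l \<theta>\<^sub>0 \<theta> > r} \<partial>P)"
proof -
  have Pp: "prob_space P" "sets P = sets S" and P'p: "prob_space P'" "sets P' = sets S"
    using P P' by (auto simp: space_prob_algebra)
  have sp: "space \<mu> = space S" "space P' = space S"
    using \<mu>(2) P'p(2) by (simp_all add: sets_eq_imp_space_eq[of \<mu>] sets_eq_imp_space_eq[of P'])
  interpret P': prob_space P' by fact
  have Qp: "prob_space (Q y)" "sets (Q y) = sets \<pi>" if "y \<in> space S" for y
    using measurable_space[OF Q that] by (auto simp: space_prob_algebra)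
  have Qm: "(\<lambda>y. measure (Q y) B) \<in> borel_measurable S" if "B \<in> sets \<pi>" for B
    by (rule measurable_compose[OF measurable_prob_algebraD[OF Q]
          measurable_measure_subprob_algebra[OF that]])
  define f where "f y = measure (Q y) {\<theta>\<in>space \<pi>. l \<theta>\<^sub>0 \<theta> > r}" for y
  define g where "g y = measure (Q y) {\<theta>\<in>space \<pi>. l \<theta>' \<theta> \<ge> r'}" for y
  have fm: "f \<in> borel_measurable S" and gm: "g \<in> borel_measurable S"
    unfolding f_def g_def by (auto intro: Qm G G')
  have f01: "0 \<le> f y" "f y \<le> 1" and g01: "0 \<le> g y" "g y \<le> 1" if "y \<in> space S" for y
    using Qp[OF that] by (auto simp: f_def g_def prob_space.prob_le_1)
  have int: "integrable P' f" "integrable P' g"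
    using f01 g01 fm gm sp P'p(2)
    by (auto intro!: P'.integrable_const_bound[of _ 1] cong: measurable_cong_sets)
  have fg: "1 \<le> f y + g y" if y: "y \<in> space S" for y
  proof -
    interpret prob_space "Q y" by (rule Qp[OF y])
    have "space (Q y) = {\<theta>\<in>space \<pi>. l \<theta>\<^sub>0 \<theta> > r} \<union> {\<theta>\<in>space \<pi>. l \<theta>' \<theta> \<ge> r'}"
    proof -
      have "l \<theta>\<^sub>0 x > r \<or> l \<theta>' x \<ge> r'" if x: "x \<in> space \<pi>" for x
      proof -
        have "l \<theta>\<^sub>0 \<theta>' \<le> l \<theta>\<^sub>0 x + l x \<theta>'" "l x \<theta>' = l \<theta>' x"
          using l \<theta> x unfolding pseudo_metric_on_def by blast+
        with \<theta>(3) show ?thesis by linarith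
      qed
      then show ?thesis
        using sets_eq_imp_space_eq[OF Qp(2)[OF y]] by auto
    qed
    then have "1 = measure (Q y) ({\<theta>\<in>space \<pi>. l \<theta>\<^sub>0 \<theta> > r} \<union> {\<theta>\<in>space \<pi>. l \<theta>' \<theta> \<ge> r'})"
      using prob_space by simp
    also have "\<dots> \<le> f y + g y"
      unfolding f_def g_def using G G' Qp(2)[OF y] by (intro measure_Un_le) auto
    finally show ?thesis .
  qed
  have "(1::real) = (\<integral>y. 1 \<partial>P')" by (simp add: P'.prob_space)
  also have "\<dots> \<le> (\<integral>y. f y + g y \<partial>P')"
    using int fg sp by (intro integral_mono) auto
  also have "\<dots> = (\<integral>y. f y \<partial>P') + (\<integral>y. g y \<partial>P')"
    using int by simp
  also have "(\<integral>y. g y \<partial>P') \<le> a"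
    using conc by (simp add: g_def)
  finally have "1 - a \<le> (\<integral>y. f y \<partial>P')" by simp
  also have "(\<integral>y. f y \<partial>P') \<le> measure P' {y \<in> space \<mu>. log_lik \<mu> P' y - log_lik \<mu> P y \<ge> ereal c}
      + exp c * (\<integral>y. f y \<partial>P)"
    using \<mu> Pp P'p P P' fm f01 sp
    by (intro expectation_change_of_measure) (auto cong: measurable_cong_sets)
  also have "\<dots> \<le> b + exp c * (\<integral>y. f y \<partial>P)"
    using lik sp by simp
  finally have "1 - a - b \<le> exp c * (\<integral>y. f y \<partial>P)" by simp
  then have "(1 - a - b) * exp (- c) \<le> exp c * (\<integral>y. f y \<partial>P) * exp (- c)"
    by (intro mult_right_mono) auto
  also have "\<dots> = (\<integral>y. f y \<partial>P)"
    by (simp add: exp_minus)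
  finally show ?thesis by (simp add: f_def)
qed

section \<open>The lower bound on the posterior mass\<close>

lemma local_modulus_near_attained:
  assumes "0 < local_modulus d T e \<theta> l" "local_modulus d T e \<theta> l < \<infinity>" "1 < q"
  obtains \<theta>' where "\<theta>' \<in> T" "l \<theta> \<theta>' \<ge> e \<theta> + e \<theta>'"
    "local_modulus d T e \<theta> l \<le> ennreal (d \<theta> \<theta>')"
    "ennreal (d \<theta> \<theta>') \<le> ennreal q * local_modulus d T e \<theta> l"
proof -
  define w where "w = enn2real (local_modulus d T e \<theta> l)"
  have w: "local_modulus d T e \<theta> l = ennreal w" "w > 0"
    using assms by (auto simp: w_def enn2real_positive_iff)
  then have "local_modulus d T e \<theta> l < ennreal q * local_modulus d T e \<theta> l"
    using assms(3) by (simp add: ennreal_mult' [symmetric] ennreal_less_iff)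
  then obtain \<theta>' where "\<theta>' \<in> T" "l \<theta> \<theta>' \<ge> e \<theta> + e \<theta>'"
    "ennreal (d \<theta> \<theta>') < ennreal q * local_modulus d T e \<theta> l"
    unfolding local_modulus_def INF_less_iff by auto
  then show thesis
    by (intro that[of \<theta>']) (auto simp: local_modulus_def intro!: INF_lower)
qed

theorem theorem2p1:
  fixes \<Theta> \<Theta>\<^sub>0 :: "'t set"
    and \<pi> :: "'t measure"
    and S :: "nat \<Rightarrow> 'y measure"
    and P :: "nat \<Rightarrow> 't \<Rightarrow> 'y measure"
    and Q :: "nat \<Rightarrow> 'y \<Rightarrow> 't measure"
    and \<mu> :: "nat \<Rightarrow> 'y measure"
    and d l :: "'t \<Rightarrow> 't \<Rightarrow> real"
    and \<epsilon> :: "nat \<Rightarrow> 't \<Rightarrow> real"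
    and K :: real
  assumes prior: "prob_space \<pi>" "space \<pi> = \<Theta>"
    and kernel: "\<And>n. n \<ge> 1 \<Longrightarrow> P n \<in> \<pi> \<rightarrow>\<^sub>M prob_algebra (S n)"
    and posterior: "\<And>n. n \<ge> 1 \<Longrightarrow> is_posterior \<pi> (S n) (P n) (Q n)"
    and d: "pre_metric_on \<Theta> d"
    and l: "pseudo_metric_on \<Theta> l"
    and subset: "\<Theta>\<^sub>0 \<subseteq> \<Theta>"
    and eps_pos: "\<And>n \<theta>. n \<ge> 1 \<Longrightarrow> \<theta> \<in> \<Theta>\<^sub>0 \<Longrightarrow> \<epsilon> n \<theta> > 0"
    and meas_ge: "\<And>n \<theta>\<^sub>0. n \<ge> 1 \<Longrightarrow> \<theta>\<^sub>0 \<in> \<Theta>\<^sub>0 \<Longrightarrow> {\<theta>\<in>\<Theta>. l \<theta>\<^sub>0 \<theta> \<ge> \<epsilon> n \<theta>\<^sub>0} \<in> sets \<pi>"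
    and meas_gt: "\<And>n \<theta>\<^sub>0. n \<ge> 1 \<Longrightarrow> \<theta>\<^sub>0 \<in> \<Theta>\<^sub>0 \<Longrightarrow> {\<theta>\<in>\<Theta>. l \<theta>\<^sub>0 \<theta> > \<epsilon> n \<theta>\<^sub>0} \<in> sets \<pi>"
    and concentration:
      "(\<lambda>n. SUP \<theta>\<^sub>0\<in>\<Theta>\<^sub>0.
          ennreal (\<integral>y. measure (Q n y) {\<theta>\<in>\<Theta>. l \<theta>\<^sub>0 \<theta> \<ge> \<epsilon> n \<theta>\<^sub>0} \<partial>P n \<theta>\<^sub>0)) \<longlonglongrightarrow> 0"
    and dominating: "\<And>n. n \<ge> 1 \<Longrightarrow> sigma_finite_measure (\<mu> n)"
      "\<And>n. n \<ge> 1 \<Longrightarrow> sets (\<mu> n) = sets (S n)"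
      "\<And>n \<theta>. n \<ge> 1 \<Longrightarrow> \<theta> \<in> \<Theta>\<^sub>0 \<Longrightarrow> absolutely_continuous (\<mu> n) (P n \<theta>)"
    and K_pos: "K > 0"
    and log_lik_bound:
      "(\<lambda>n. SUP (\<theta>, \<theta>') \<in> {(\<theta>, \<theta>'). \<theta> \<in> \<Theta>\<^sub>0 \<and> \<theta>' \<in> \<Theta>\<^sub>0 \<and>
              local_modulus d \<Theta>\<^sub>0 (\<epsilon> n) \<theta> l \<le> ennreal (d \<theta> \<theta>') \<and>
              ennreal (d \<theta> \<theta>') \<le> 2 * local_modulus d \<Theta>\<^sub>0 (\<epsilon> n) \<theta> l}.
          emeasure (P n \<theta>')
            {y \<in> space (S n). log_lik (\<mu> n) (P n \<theta>') y - log_lik (\<mu> n) (P n \<theta>) y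
                                \<ge> ereal (K * real n * (d \<theta> \<theta>')\<^sup>2)}) \<longlonglongrightarrow> 0"
    and modulus: "(\<lambda>n. of_nat n * (global_modulus d \<Theta>\<^sub>0 (\<epsilon> n) l)\<^sup>2) \<longlonglongrightarrow> \<infinity>"
  shows "\<forall>\<^sub>F n in sequentially. \<forall>\<theta>\<^sub>0\<in>\<Theta>\<^sub>0.
    (\<integral>y. measure (Q n y) {\<theta>\<in>\<Theta>. l \<theta>\<^sub>0 \<theta> > \<epsilon> n \<theta>\<^sub>0} \<partial>P n \<theta>\<^sub>0)
      \<ge> exp_neg (ennreal (3 * K * real n) * (local_modulus d \<Theta>\<^sub>0 (\<epsilon> n) \<theta>\<^sub>0 l)\<^sup>2)"
proof -
  \<comment> \<open>The two error terms are allowed 1/4 each, which leaves a factor 1/2 in the lower bound. The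
    threshold \<open>1/K\<close> makes the reserve \<open>(3 - 25/16) K n \<Omega>\<^sup>2\<close> in the exponent larger than
    \<open>1 > ln 2\<close>, which pays for that factor.\<close>
  have ev_conc: "\<forall>\<^sub>F n in sequentially. (SUP \<theta>\<^sub>0\<in>\<Theta>\<^sub>0.
      ennreal (\<integral>y. measure (Q n y) {\<theta>\<in>\<Theta>. l \<theta>\<^sub>0 \<theta> \<ge> \<epsilon> n \<theta>\<^sub>0} \<partial>P n \<theta>\<^sub>0)) < ennreal (1/4)"
    using concentration by (rule order_tendstoD) simp
  note ev_lik = order_tendstoD(2)[OF log_lik_bound, of "ennreal (1/4)", simplified]
  have ev_mod: "\<forall>\<^sub>F n in sequentially.
      ennreal (1/K) < of_nat n * (global_modulus d \<Theta>\<^sub>0 (\<epsilon> n) l)\<^sup>2"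
    using modulus by (rule order_tendstoD) simp
  show ?thesis
    using ev_conc ev_lik ev_mod eventually_ge_at_top[of 1]
  proof eventually_elim
    case (elim n)
    show ?case
    proof
      fix \<theta>\<^sub>0 assume \<theta>\<^sub>0: "\<theta>\<^sub>0 \<in> \<Theta>\<^sub>0"
      let ?\<Omega> = "local_modulus d \<Theta>\<^sub>0 (\<epsilon> n) \<theta>\<^sub>0 l"
      let ?E = "\<integral>y. measure (Q n y) {\<theta>\<in>\<Theta>. l \<theta>\<^sub>0 \<theta> > \<epsilon> n \<theta>\<^sub>0} \<partial>P n \<theta>\<^sub>0"
      have n: "real n > 0" using elim by simp
      have "global_modulus d \<Theta>\<^sub>0 (\<epsilon> n) l \<le> ?\<Omega>"
        unfolding global_modulus_def using \<theta>\<^sub>0 by (rule INF_lower)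
      then have "of_nat n * (global_modulus d \<Theta>\<^sub>0 (\<epsilon> n) l)\<^sup>2 \<le> of_nat n * ?\<Omega>\<^sup>2"
        by (intro mult_left_mono power_mono) auto
      with elim(3) have big: "ennreal (1/K) < of_nat n * ?\<Omega>\<^sup>2" by (rule less_le_trans)
      show "?E \<ge> exp_neg (ennreal (3 * K * real n) * ?\<Omega>\<^sup>2)"
      proof (cases "?\<Omega> = \<infinity>")
        case True
        then show ?thesis
          using K_pos n by (simp add: exp_neg_def ennreal_mult_top power2_eq_square)
      next
        case False
        have pos: "0 < ?\<Omega>" using big by (auto simp: zero_less_iff_neq_zero)
        define w where "w = enn2real ?\<Omega>"
        have w: "?\<Omega> = ennreal w" "w > 0"
          using pos False by (auto simp: w_def enn2real_positive_iff less_top)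
        have big': "1 < K * (real n * w\<^sup>2)"
        proof -
          have "ennreal (1/K) < ennreal (real n * w\<^sup>2)"
            using big w by (simp add: ennreal_mult' ennreal_power ennreal_of_nat_eq_real_of_nat)
          then have "1/K < real n * w\<^sup>2"
            using K_pos by (subst (asm) ennreal_less_iff) auto
          then show ?thesis using K_pos by (simp add: field_simps)
        qed
        obtain \<theta>' where \<theta>': "\<theta>' \<in> \<Theta>\<^sub>0" "l \<theta>\<^sub>0 \<theta>' \<ge> \<epsilon> n \<theta>\<^sub>0 + \<epsilon> n \<theta>'"
          "?\<Omega> \<le> ennreal (d \<theta>\<^sub>0 \<theta>')" "ennreal (d \<theta>\<^sub>0 \<theta>') \<le> ennreal (5/4) * ?\<Omega>"
          using pos False by (auto intro: local_modulus_near_attained[of d \<Theta>\<^sub>0 "\<epsilon> n" \<theta>\<^sub>0 l "5/4"] simp: less_top)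
        have "ennreal (d \<theta>\<^sub>0 \<theta>') \<le> 2 * ?\<Omega>"
        proof -
          have "ennreal (5/4) \<le> ennreal 2" by (intro ennreal_leI) simp
          then have "ennreal (5/4) * ?\<Omega> \<le> 2 * ?\<Omega>"
            by (intro mult_right_mono) auto
          with \<theta>'(4) show ?thesis by (rule order_trans)
        qed
        with \<theta>\<^sub>0 \<theta>' have "emeasure (P n \<theta>')
            {y \<in> space (S n). log_lik (\<mu> n) (P n \<theta>') y - log_lik (\<mu> n) (P n \<theta>\<^sub>0) y
               \<ge> ereal (K * real n * (d \<theta>\<^sub>0 \<theta>')\<^sup>2)} < ennreal (1/4)"
          using elim(2) by (intro le_less_trans[OF _ elim(2)] SUP_upper2[of "(\<theta>\<^sub>0, \<theta>')"]) auto
        then have lik: "measure (P n \<theta>')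
            {y \<in> space (S n). log_lik (\<mu> n) (P n \<theta>') y - log_lik (\<mu> n) (P n \<theta>\<^sub>0) y
               \<ge> ereal (K * real n * (d \<theta>\<^sub>0 \<theta>')\<^sup>2)} \<le> 1/4"
          unfolding measure_def by (intro enn2real_leI) auto
        have "ennreal (\<integral>y. measure (Q n y) {\<theta>\<in>\<Theta>. l \<theta>' \<theta> \<ge> \<epsilon> n \<theta>'} \<partial>P n \<theta>') \<le> ennreal (1/4)"
          using \<theta>'(1) by (intro less_imp_le[OF le_less_trans[OF _ elim(1)]] SUP_upper2[of \<theta>']) auto
        then have conc: "(\<integral>y. measure (Q n y) {\<theta>\<in>\<Theta>. l \<theta>' \<theta> \<ge> \<epsilon> n \<theta>'} \<partial>P n \<theta>') \<le> 1/4"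
          by (subst (asm) ennreal_le_iff) auto
        have \<theta>_in: "\<theta>\<^sub>0 \<in> \<Theta>" "\<theta>' \<in> \<Theta>" using \<theta>\<^sub>0 \<theta>'(1) subset by auto
        have Pn: "P n \<theta> \<in> space (prob_algebra (S n))" if "\<theta> \<in> \<Theta>" for \<theta>
          using measurable_space[OF kernel[OF elim(4)]] that prior(2) by auto
        have Qn: "Q n \<in> S n \<rightarrow>\<^sub>M prob_algebra \<pi>"
          using posterior[OF elim(4)] by (simp add: is_posterior_def)
        have main: "(1 - 1/4 - 1/4) * exp (- (K * real n * (d \<theta>\<^sub>0 \<theta>')\<^sup>2)) \<le> ?E"
          using posterior_mass_outside_ball_lower_bound[of \<pi> l "Q n" "S n" "\<mu> n" "P n \<theta>\<^sub>0" "P n \<theta>'"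
              \<theta>\<^sub>0 \<theta>' "\<epsilon> n \<theta>\<^sub>0" "\<epsilon> n \<theta>'" "1/4" "K * real n * (d \<theta>\<^sub>0 \<theta>')\<^sup>2" "1/4", unfolded prior(2),
              OF l Qn dominating(1,2)[OF elim(4)] Pn[OF \<theta>_in(1)] dominating(3)[OF elim(4) \<theta>\<^sub>0]
              Pn[OF \<theta>_in(2)] dominating(3)[OF elim(4) \<theta>'(1)] \<theta>_in \<theta>'(2)
              meas_gt[OF elim(4) \<theta>\<^sub>0] meas_ge[OF elim(4) \<theta>'(1)] conc lik] .
        have d0: "0 \<le> d \<theta>\<^sub>0 \<theta>'"
          using d \<theta>_in by (auto simp: pre_metric_on_def)
        have "d \<theta>\<^sub>0 \<theta>' \<le> 5/4 * w"
        proof -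
          have "ennreal (d \<theta>\<^sub>0 \<theta>') \<le> ennreal (5/4 * w)"
            using \<theta>'(4) w ennreal_mult'[of "5/4" w] by simp
          then show ?thesis using w(2) by (subst (asm) ennreal_le_iff) auto
        qed
        then have "(d \<theta>\<^sub>0 \<theta>')\<^sup>2 \<le> (5/4 * w)\<^sup>2"
          using d0 by (intro power_mono)
        then have "K * real n * (d \<theta>\<^sub>0 \<theta>')\<^sup>2 \<le> K * real n * (5/4 * w)\<^sup>2"
          using K_pos n by (intro mult_left_mono) auto
        also have "\<dots> = 25/16 * (K * (real n * w\<^sup>2))"
          by (simp add: power2_eq_square)
        also have "\<dots> \<le> 3 * (K * (real n * w\<^sup>2)) - ln 2"
          using big' ln_2_less_1 by linarith
        finally have exponent: "K * real n * (d \<theta>\<^sub>0 \<theta>')\<^sup>2 \<le> 3 * (K * (real n * w\<^sup>2)) - ln 2" .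
        have "exp (- (3 * (K * (real n * w\<^sup>2)))) =
            (1 - 1/4 - 1/4) * exp (- (3 * (K * (real n * w\<^sup>2)) - ln 2))"
          by (simp add: exp_diff exp_minus field_simps)
        also have "\<dots> \<le> (1 - 1/4 - 1/4) * exp (- (K * real n * (d \<theta>\<^sub>0 \<theta>')\<^sup>2))"
          using exponent by (intro mult_left_mono) auto
        also note main
        finally have "exp (- (3 * (K * (real n * w\<^sup>2)))) \<le> ?E" .
        moreover have "ennreal (3 * K * real n) * ?\<Omega>\<^sup>2 = ennreal (3 * (K * (real n * w\<^sup>2)))"
          using w K_pos by (simp add: ennreal_power ennreal_mult' [symmetric] mult.assoc)
        moreover have "0 \<le> 3 * (K * (real n * w\<^sup>2))"
          using big' by linarith
        ultimately show ?thesis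
          by (simp add: exp_neg_def)
      qed
    qed
  qed
qed

end
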